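(* Let $0<q<1$ and let $a,b\in\mathbb{C}\setminus\{0\}$ be such that $q^{k}a\neq1$ for $k\ge1$ and $q^kab\neq1$ for $k\ge2$. For $n\in\mathbb{Z}$ let $E_n[z;a,b,c,d\mid q]$ denote the nonsymmetric Askey-Wilson polynomial in vector-valued form. Then for every $x\in\mathbb{C}\setminus\{0\}$ the following limits hold componentwise: $$\lim_{\lambda\downarrow0}\lambda^nE_{-n}[\lambda^{-1}x;-q^{1/2}a,qb\lambda,-q^{1/2},\lambda^{-1}\mid q]=\begin{pmatrix}P_n(x;a,b;q)\\ q^{-3/2}a^{-1}b^{-1}P_{n-1}(x;qa,qb;q)\end{pmatrix}\qquad(n=1,2,\ldots),$$ $$\lim_{\lambda\downarrow0}\lambda^nE_{n}[\lambda^{-1}x;-q^{1/2}a,qb\lambda,-q^{1/2},\lambda^{-1}\mid q]=\begin{pmatrix}P_n(x;a,b;q)\\ -\dfrac{q^{n-1/2}(1-q^n)}{1-q^{n+1}ab}\,P_{n-1}(x;qa,qb;q)\end{pmatrix}\qquad(n=0,1,2,\ldots),$$ where $P_n(x;a,b;q)$ are the monic little $q$-Jacobi polynomials and the second component is $0$ for $n=0$ in the last formula.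
   Context: Pochhammer symbols: $(a;q)_n=\prod_{j=0}^{n-1}(1-aq^j)$, $(a_1,\ldots,a_r;q)_n=(a_1;q)_n\cdots(a_r;q)_n$. Monic Askey-Wilson polynomials: $$P_n[z;a,b,c,d\mid q]=\frac{(ab,ac,ad;q)_n}{a^n(abcdq^{n-1};q)_n}\sum_{k=0}^n\frac{(q^{-n},q^{n-1}abcd,az,az^{-1};q)_k}{(ab,ac,ad,q;q)_k}q^k,$$ with the factor $(ab,ac,ad;q)_n$ multiplied through and cancelled against the denominators. Nonsymmetric Askey-Wilson polynomials in vector-valued form (pairs of symmetric Laurent polynomials in $z$): $$E_{-n}[z;a,b,c,d\mid q]=\begin{pmatrix}P_n[z;a,b,c,d\mid q]\\-a^{-1}b^{-1}P_{n-1}[z;qa,qb,c,d\mid q]\end{pmatrix}\quad(n\ge1),$$ $$E_n[z;a,b,c,d\mid q]=\begin{pmatrix}P_n[z;a,b,c,d\mid q]\\-\dfrac{(1-q^n)(1-q^{n-1}cd)}{(1-q^nab)(1-q^{n-1}abcd)}\,P_{n-1}[z;qa,qb,c,d\mid q]\end{pmatrix}\quad(n\ge0),$$ where $(1-q^n)P_{n-1}=0$ for $n=0$. Monic little $q$-Jacobi polynomials: $$P_n(x;a,b;q)=\frac{(-1)^nq^{n(n-1)/2}(aq;q)_n}{(abq^{n+1};q)_n}\sum_{k=0}^n\frac{(q^{-n},abq^{n+1};q)_k}{(aq,q;q)_k}(qx)^k.$$ *)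

theory Defs
  imports "HOL-Analysis.Analysis"
begin

definition qpoch :: "complex \<Rightarrow> complex \<Rightarrow> nat \<Rightarrow> complex" where
  "qpoch a q n = (\<Prod>j<n. 1 - a * q ^ j)"

(* The prefactor (ab,ac,ad;q)_n is cancelled against (ab,ac,ad;q)_k in the k-th term, using
   (u;q)_n = (u;q)_k (u q^k;q)_(n-k).  So no condition on ab, ac, ad is needed.
   Integer powers (powi) are used because the exponent n - 1 is negative for n = 0. *)
definition askey_wilson ::
  "nat \<Rightarrow> complex \<Rightarrow> complex \<Rightarrow> complex \<Rightarrow> complex \<Rightarrow> complex \<Rightarrow> complex \<Rightarrow> complex" where
  "askey_wilson n z a b c d q =
     1 / (a ^ n * qpoch (a * b * c * d * q powi (int n - 1)) q n) *
     (\<Sum>k\<le>n.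
        qpoch (q powi (- int n)) q k * qpoch (q powi (int n - 1) * a * b * c * d) q k *
        qpoch (a * z) q k * qpoch (a * inverse z) q k *
        (qpoch (a * b * q ^ k) q (n - k) * qpoch (a * c * q ^ k) q (n - k) *
         qpoch (a * d * q ^ k) q (n - k)) / qpoch q q k * q ^ k)"

(* The index ranges over all integers: the negative ones give E_(-n) with n \<ge> 1.
   The second component at index 0 is 0 by the convention (1 - q^n) P_(n-1) = 0 for n = 0. *)
definition nonsym_askey_wilson ::
  "int \<Rightarrow> complex \<Rightarrow> complex \<Rightarrow> complex \<Rightarrow> complex \<Rightarrow> complex \<Rightarrow> complex \<Rightarrow> complex \<times> complex" where
  "nonsym_askey_wilson m z a b c d q =
     (let n = nat \<bar>m\<bar> in
      (askey_wilson n z a b c d q,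
       if m < 0 then
         - (inverse a * inverse b * askey_wilson (n - 1) z (q * a) (q * b) c d q)
       else if m = 0 then 0
       else
         - ((1 - q ^ n) * (1 - q ^ (n - 1) * c * d) /
            ((1 - q ^ n * a * b) * (1 - q ^ (n - 1) * a * b * c * d)) *
            askey_wilson (n - 1) z (q * a) (q * b) c d q)))"

definition little_q_jacobi ::
  "nat \<Rightarrow> complex \<Rightarrow> complex \<Rightarrow> complex \<Rightarrow> complex \<Rightarrow> complex" where
  "little_q_jacobi n x a b q =
     (-1) ^ n * q ^ (n * (n - 1) div 2) * qpoch (a * q) q n / qpoch (a * b * q ^ (n + 1)) q n *
     (\<Sum>k\<le>n.
        qpoch (q powi (- int n)) q k * qpoch (a * b * q ^ (n + 1)) q k /
        (qpoch (a * q) q k * qpoch q q k) * (q * x) ^ k)"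

end

theory Submission imports Defs begin

text \<open>
  Under the substitution \<open>(A, B, C, D) = (- s a, q b l, - s, 1 / l)\<close>, \<open>z = x / l\<close>, with \<open>s\<^sup>2 = q\<close>,
  the products \<open>A B C D = q\<^sup>2 a b\<close> and \<open>A C = q a\<close> do not depend on \<open>l\<close>, while \<open>A B\<close> and \<open>A / z\<close>
  are multiples of \<open>l\<close>, so that their shifted factorials tend to \<open>1\<close>. Only \<open>A z\<close> and \<open>A D\<close> blow up,
  both like \<open>1 / l\<close>. In the \<open>k\<close>-th summand they occur in \<open>(A z; q)\<^sub>k\<close> and \<open>(A D q\<^sup>k; q)\<^sub>n\<^sub>-\<^sub>k\<close>, hence
  with \<open>k + (n - k) = n\<close> linear factors in total, and the prefactor \<open>l\<^sup>n\<close> provides exactly one \<open>l\<close> for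
  each of them. What is left of these factors is \<open>(s a)\<^sup>n x\<^sup>k\<close> times a product of powers of \<open>q\<close> that
  telescopes to \<open>q\<^bsup>n(n-1)/2\<^esup>\<close> independently of \<open>k\<close>. So the limit can be taken termwise in
  a finite sum, and it gives the little \<open>q\<close>-Jacobi polynomial
  (lemma \<open>askey_wilson_tendsto_little_q_jacobi\<close>).

  The second components need no new limit of polynomials: replacing \<open>A, B\<close> by \<open>q A, q B\<close>
  is the same as replacing \<open>a, b\<close> by \<open>q a, q b\<close>, and only \<open>n - 1\<close> of the \<open>n\<close> factors \<open>l\<close> are
  used up by the polynomial of degree \<open>n - 1\<close>. The remaining \<open>l\<close> compensates the pole of
  \<open>1 / (A B)\<close> for negative index, and that of \<open>1 - q\<^bsup>n-1\<^esup> C D\<close> for positive index.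
\<close>

section \<open>Shifted factorials\<close>

lemma prod_lessThan_add:
  fixes f :: "nat \<Rightarrow> 'a::comm_monoid_mult"
  shows "(\<Prod>j<m + n. f j) = (\<Prod>j<m. f j) * (\<Prod>j<n. f (m + j))"
  by (induction n) (simp_all add: mult.assoc)

lemma qpoch_split:
  assumes "k \<le> n"
  shows "qpoch u q n = qpoch u q k * qpoch (u * q ^ k) q (n - k)"
proof -
  have "(\<Prod>j<k + (n - k). 1 - u * q ^ j) =
      (\<Prod>j<k. 1 - u * q ^ j) * (\<Prod>j<n - k. 1 - u * q ^ (k + j))"
    by (rule prod_lessThan_add)
  thus ?thesis
    using assms by (simp add: qpoch_def power_add mult.assoc)
qed

lemma qpoch_tendsto_1:
  assumes "(f \<longlongrightarrow> 0) F"
  shows "((\<lambda>l. qpoch (f l) q m) \<longlongrightarrow> 1) F"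
proof -
  have "((\<lambda>l. \<Prod>j<m. 1 - f l * q ^ j) \<longlongrightarrow> (\<Prod>j<m. 1 - 0 * q ^ j)) F"
    by (intro tendsto_intros assms)
  thus ?thesis by (simp add: qpoch_def)
qed

text \<open>Each of the \<open>m\<close> factors \<open>1 - u q\<^sup>j / l\<close> has a simple pole, which one power of \<open>l\<close> removes.\<close>

lemma qpoch_pole_tendsto:
  "((\<lambda>l. complex_of_real l ^ m * qpoch (u * inverse (of_real l)) q m)
     \<longlongrightarrow> (\<Prod>j<m. - (u * q ^ j))) (at_right 0)"
proof -
  have "((\<lambda>l. \<Prod>j<m. complex_of_real l - u * q ^ j) \<longlongrightarrow> (\<Prod>j<m. of_real 0 - u * q ^ j)) (at_right 0)"
    by (intro tendsto_intros)
  moreover have "\<forall>\<^sub>F l in at_right 0. (\<Prod>j<m. complex_of_real l - u * q ^ j) =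
      of_real l ^ m * qpoch (u * inverse (of_real l)) q m"
    using eventually_at_right_less[of "0::real"]
  proof eventually_elim
    case (elim l)
    have "of_real l ^ m * qpoch (u * inverse (of_real l)) q m =
        (\<Prod>j<m. complex_of_real l * (1 - u * inverse (of_real l) * q ^ j))"
      by (simp add: qpoch_def prod.distrib)
    also have "\<dots> = (\<Prod>j<m. complex_of_real l - u * q ^ j)"
      using elim by (intro prod.cong) (simp_all add: field_simps)
    finally show ?case by simp
  qed
  ultimately show ?thesis
    by (auto elim: Lim_transform_eventually)
qed

lemma prod_powers: "(\<Prod>j<n. q ^ j) = (q::complex) ^ (n * (n - 1) div 2)"
proof -
  have "(\<Prod>j<n. q ^ j) = q ^ (\<Sum>j<n. j)"
    by (simp add: power_sum)
  also have "(\<Sum>j<n. j) = n * (n - 1) div 2"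
    using Sum_Ico_nat[of 0 n] by (simp add: lessThan_atLeast0)
  finally show ?thesis .
qed

text \<open>
  The exponents of \<open>q\<close> run over \<open>0, \<dots>, k - 1\<close> in the first product and over \<open>k, \<dots>, n - 1\<close> in the
  second one, so together they do not depend on \<open>k\<close>.
\<close>

lemma leading_coefficients_telescope:
  fixes u x q :: complex
  assumes "k \<le> n"
  shows "(\<Prod>j<k. u * x * q ^ j) * (\<Prod>j<n - k. u * q ^ k * q ^ j) =
    u ^ n * x ^ k * q ^ (n * (n - 1) div 2)"
proof -
  have "(\<Prod>j<k + (n - k). u * q ^ j) = (\<Prod>j<k. u * q ^ j) * (\<Prod>j<n - k. u * q ^ (k + j))"
    by (rule prod_lessThan_add)
  hence "(\<Prod>j<k. u * q ^ j) * (\<Prod>j<n - k. u * q ^ k * q ^ j) = (\<Prod>j<n. u * q ^ j)"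
    using assms by (simp add: power_add mult.assoc)
  moreover have "(\<Prod>j<k. u * x * q ^ j) = x ^ k * (\<Prod>j<k. u * q ^ j)"
    by (simp add: prod.distrib mult_ac power_mult_distrib)
  moreover have "(\<Prod>j<n. u * q ^ j) = u ^ n * q ^ (n * (n - 1) div 2)"
    by (simp add: prod.distrib prod_powers)
  ultimately show ?thesis by (simp add: mult_ac)
qed

section \<open>From Askey-Wilson to little q-Jacobi polynomials\<close>

text \<open>
  The Askey-Wilson sum is rewritten as \<open>\<Sum>k. w k * G l k\<close>, where \<open>w\<close> is free of \<open>l\<close> and \<open>G\<close> collects
  the four shifted factorials that depend on \<open>l\<close>, with \<open>l\<^sup>n\<close> distributed over the two singular ones
  as \<open>l\<^sup>k l\<^bsup>n-k\<^esup>\<close>. Either square root \<open>s\<close> of \<open>q\<close> gives the same limit, because \<open>s\<close> survives only in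
  \<open>(s a)\<^sup>n\<close>, which cancels against the normalising \<open>A\<^sup>n = (- s a)\<^sup>n\<close> up to sign.
\<close>

lemma askey_wilson_tendsto_little_q_jacobi:
  fixes q s a b x :: complex
  assumes "q \<noteq> 0" and s: "s * s = q" and "a \<noteq> 0"
    and a: "\<And>k::nat. k \<ge> 1 \<Longrightarrow> q ^ k * a \<noteq> 1"
  shows "((\<lambda>l. of_real l ^ n *
      askey_wilson n (inverse (of_real l) * x) (- s * a) (q * b * of_real l) (- s)
        (inverse (of_real l)) q)
    \<longlongrightarrow> little_q_jacobi n x a b q) (at_right 0)"
proof -
  define N where "N = a * b * q ^ (n + 1)"
  define w where "w k = qpoch (q powi (- int n)) q k * qpoch N q k *
      qpoch (a * q * q ^ k) q (n - k) / qpoch q q k * q ^ k" for k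
  define G where "G l k =
      (of_real l ^ k * qpoch (- s * a * x * inverse (of_real l)) q k) *
      (of_real l ^ (n - k) * qpoch (- s * a * q ^ k * inverse (of_real l)) q (n - k)) *
      qpoch (- s * a * inverse x * of_real l) q k *
      qpoch (- s * a * q * b * q ^ k * of_real l) q (n - k)"
    for l :: real and k
  have "s \<noteq> 0" using assms by auto
  have N: "q powi (int n - 1) * (q * q * a * b) = N"
  proof -
    have "q powi (int n - 1) * (q * q) = q powi (int n + 1)"
      using \<open>q \<noteq> 0\<close> by (simp add: power_int_diff power_int_add field_simps)
    also have "\<dots> = q ^ (n + 1)"
      using power_int_of_nat[of q "n + 1"] by (simp add: add.commute)
    finally show ?thesis by (simp add: N_def mult_ac)
  qed

  have qa_nz: "qpoch (a * q) q k \<noteq> 0" for k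
    using a[of "Suc j" for j] by (auto simp: qpoch_def mult_ac)

  have G_lim: "((\<lambda>l. G l k) \<longlongrightarrow> (s * a) ^ n * x ^ k * q ^ (n * (n - 1) div 2)) (at_right 0)"
    if "k \<le> n" for k
  proof -
    have lin: "((\<lambda>l. u * complex_of_real l) \<longlongrightarrow> 0) (at_right 0)" for u
    proof -
      have "((\<lambda>l. u * complex_of_real l) \<longlongrightarrow> u * of_real 0) (at_right 0)"
        by (intro tendsto_intros)
      thus ?thesis by simp
    qed
    have "((\<lambda>l. G l k) \<longlongrightarrow>
        (\<Prod>j<k. - (- s * a * x * q ^ j)) * (\<Prod>j<n - k. - (- s * a * q ^ k * q ^ j)) * 1 * 1)
        (at_right 0)"
      unfolding G_def by (intro tendsto_mult qpoch_pole_tendsto qpoch_tendsto_1 lin)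
    thus ?thesis
      using leading_coefficients_telescope[OF that, of "s * a" x q] by simp
  qed

  have "((\<lambda>l. 1 / ((- s * a) ^ n * qpoch N q n) * (\<Sum>k\<le>n. w k * G l k)) \<longlongrightarrow>
      1 / ((- s * a) ^ n * qpoch N q n) *
        (\<Sum>k\<le>n. w k * ((s * a) ^ n * x ^ k * q ^ (n * (n - 1) div 2)))) (at_right 0)"
    by (intro tendsto_intros G_lim) auto
  also have "1 / ((- s * a) ^ n * qpoch N q n) *
        (\<Sum>k\<le>n. w k * ((s * a) ^ n * x ^ k * q ^ (n * (n - 1) div 2))) =
      (- 1) ^ n * q ^ (n * (n - 1) div 2) / qpoch N q n * (\<Sum>k\<le>n. w k * x ^ k)"
  proof -
    have sign: "(s * a) ^ n / (- s * a) ^ n = (- 1) ^ n"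
      using \<open>s \<noteq> 0\<close> \<open>a \<noteq> 0\<close> by (simp flip: power_divide)
    have "1 / ((- s * a) ^ n * qpoch N q n) *
        (\<Sum>k\<le>n. w k * ((s * a) ^ n * x ^ k * q ^ (n * (n - 1) div 2))) =
      ((s * a) ^ n / (- s * a) ^ n) * q ^ (n * (n - 1) div 2) / qpoch N q n * (\<Sum>k\<le>n. w k * x ^ k)"
      by (simp add: sum_distrib_left sum_distrib_right sum_divide_distrib mult_ac)
    thus ?thesis unfolding sign .
  qed
  also have "\<dots> = little_q_jacobi n x a b q"
  proof -
    \<comment> \<open>The little \<open>q\<close>-Jacobi sum divides by \<open>(a q; q)\<^sub>k\<close>, the Askey-Wilson sum multiplies by
      the complementary factor \<open>(a q\<^bsup>k+1\<^esup>; q)\<^sub>n\<^sub>-\<^sub>k\<close>; they agree since \<open>(a q; q)\<^sub>k\<close> does not vanish.\<close>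
    have "w k * x ^ k = qpoch (a * q) q n * (qpoch (q powi (- int n)) q k * qpoch N q k /
        (qpoch (a * q) q k * qpoch q q k) * (q * x) ^ k)" if "k \<le> n" for k
      using qpoch_split[OF that, of "a * q" q] qa_nz[of k]
      by (simp add: w_def power_mult_distrib)
    hence "(\<Sum>k\<le>n. w k * x ^ k) = qpoch (a * q) q n *
        (\<Sum>k\<le>n. qpoch (q powi (- int n)) q k * qpoch N q k /
          (qpoch (a * q) q k * qpoch q q k) * (q * x) ^ k)"
      by (simp add: sum_distrib_left)
    thus ?thesis
      by (simp add: little_q_jacobi_def N_def)
  qed
  finally have "((\<lambda>l. 1 / ((- s * a) ^ n * qpoch N q n) * (\<Sum>k\<le>n. w k * G l k)) \<longlongrightarrow>
      little_q_jacobi n x a b q) (at_right 0)" .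

  moreover have "\<forall>\<^sub>F l in at_right 0.
      1 / ((- s * a) ^ n * qpoch N q n) * (\<Sum>k\<le>n. w k * G l k) =
      of_real l ^ n * askey_wilson n (inverse (of_real l) * x) (- s * a) (q * b * of_real l) (- s)
        (inverse (of_real l)) q"
    using eventually_at_right_less[of "0::real"]
  proof eventually_elim
    case (elim l)
    define L where "L = complex_of_real l"
    have "L \<noteq> 0" using elim by (simp add: L_def)
    have abcd: "- s * a * (q * b * L) * - s * inverse L = q * q * a * b"
      using \<open>L \<noteq> 0\<close> by (simp add: field_simps flip: s)
    have e1: "(- s * a) * (q * b * L) * (- s) * inverse L * q powi (int n - 1) = N"
      unfolding abcd using N by (simp only: mult.commute)
    have e2: "q powi (int n - 1) * (- s * a) * (q * b * L) * (- s) * inverse L = N"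
      using e1 by (simp only: mult_ac)
    have e3: "- s * a * (inverse L * x) = - s * a * x * inverse L"
      by (simp add: mult_ac)
    have e4: "- s * a * inverse (inverse L * x) = - s * a * inverse x * L"
      by (simp add: mult_ac)
    have e5: "- s * a * (q * b * L) * q ^ k = - s * a * q * b * q ^ k * L" for k
      by (simp add: mult_ac)
    have e6: "- s * a * - s * q ^ k = a * q * q ^ k" for k
      by (simp add: mult_ac flip: s)
    have e7: "- s * a * inverse L * q ^ k = - s * a * q ^ k * inverse L" for k
      by (simp add: mult_ac)
    have "L ^ n * askey_wilson n (inverse L * x) (- s * a) (q * b * L) (- s) (inverse L) q =
        1 / ((- s * a) ^ n * qpoch N q n) * (\<Sum>k\<le>n. L ^ n *
          (qpoch (q powi (- int n)) q k * qpoch N q k *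
           qpoch (- s * a * x * inverse L) q k * qpoch (- s * a * inverse x * L) q k *
           (qpoch (- s * a * q * b * q ^ k * L) q (n - k) * qpoch (a * q * q ^ k) q (n - k) *
            qpoch (- s * a * q ^ k * inverse L) q (n - k)) / qpoch q q k * q ^ k))"
      unfolding askey_wilson_def e1 e2 e3 e4 e5 e6 e7 mult.left_commute[of "L ^ n" "1 / _"]
        sum_distrib_left[of "L ^ n"]
      by (rule refl)
    also have "\<dots> = 1 / ((- s * a) ^ n * qpoch N q n) * (\<Sum>k\<le>n. w k * G l k)"
    proof (rule arg_cong2[where f = "(*)", OF refl sum.cong[OF refl]])
      fix k assume "k \<in> {..n}"
      hence split: "L ^ n = L ^ k * L ^ (n - k)" by (simp flip: power_add)
      show "L ^ n * (qpoch (q powi (- int n)) q k * qpoch N q k *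
           qpoch (- s * a * x * inverse L) q k * qpoch (- s * a * inverse x * L) q k *
           (qpoch (- s * a * q * b * q ^ k * L) q (n - k) * qpoch (a * q * q ^ k) q (n - k) *
            qpoch (- s * a * q ^ k * inverse L) q (n - k)) / qpoch q q k * q ^ k) = w k * G l k"
        unfolding split w_def G_def L_def[symmetric] by (simp only: divide_inverse mult_ac)
    qed
    finally show ?case by (simp add: L_def)
  qed
  ultimately show ?thesis by (rule Lim_transform_eventually)
qed

section \<open>The vector-valued limits\<close>

theorem mainTheorem3:
  fixes q :: real and a b x :: complex
  assumes "0 < q" and "q < 1"
    and "a \<noteq> 0" and "b \<noteq> 0"
    and "\<forall>k::nat. k \<ge> 1 \<longrightarrow> of_real q ^ k * a \<noteq> 1"
    and "\<forall>k::nat. k \<ge> 2 \<longrightarrow> of_real q ^ k * a * b \<noteq> 1"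
    and "x \<noteq> 0"
  shows
    "(\<forall>n::nat. n \<ge> 1 \<longrightarrow>
       ((\<lambda>l::real. l ^ n *\<^sub>R
           nonsym_askey_wilson (- int n) (inverse (of_real l) * x)
             (- of_real (q powr (1/2)) * a) (of_real q * b * of_real l)
             (- of_real (q powr (1/2))) (inverse (of_real l)) (of_real q))
        \<longlongrightarrow>
         (little_q_jacobi n x a b (of_real q),
          of_real (q powr (-3/2)) * inverse a * inverse b *
            little_q_jacobi (n - 1) x (of_real q * a) (of_real q * b) (of_real q)))
        (at_right 0)) \<and>
     (\<forall>n::nat.
       ((\<lambda>l::real. l ^ n *\<^sub>R
           nonsym_askey_wilson (int n) (inverse (of_real l) * x)
             (- of_real (q powr (1/2)) * a) (of_real q * b * of_real l)
             (- of_real (q powr (1/2))) (inverse (of_real l)) (of_real q))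
        \<longlongrightarrow>
         (little_q_jacobi n x a b (of_real q),
          if n = 0 then 0
          else - (of_real (q powr (real n - 1/2)) * (1 - of_real q ^ n) /
                  (1 - of_real q ^ (n + 1) * a * b) *
                  little_q_jacobi (n - 1) x (of_real q * a) (of_real q * b) (of_real q))))
        (at_right 0))"
proof -
  define Q where "Q = complex_of_real q"
  define s where "s = complex_of_real (q powr (1/2))"
  have Q: "Q \<noteq> 0" using assms by (simp add: Q_def)
  have s: "s * s = Q"
    using assms by (simp add: s_def Q_def flip: of_real_mult powr_add)
  have "s \<noteq> 0" using Q s by auto
  have s_neg: "complex_of_real (q powr (-3/2)) = inverse (s * Q)"
  proof -
    have "q powr (-3/2) = inverse (q powr (1/2 + 1))"
      by (simp flip: powr_minus)
    also have "\<dots> = inverse (q powr (1/2) * q)"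
      using assms by (subst powr_add) simp
    finally show ?thesis by (simp add: s_def Q_def)
  qed
  have s_pos: "complex_of_real (q powr (real n - 1/2)) = Q ^ (n - 1) * s" if "n \<ge> 1" for n
  proof -
    have "real n - 1/2 = real (n - 1) + 1/2" using that by (simp add: of_nat_diff)
    hence "q powr (real n - 1/2) = q powr real (n - 1) * q powr (1/2)"
      by (simp only: powr_add)
    also have "q powr real (n - 1) = q ^ (n - 1)"
      using assms by (intro powr_realpow)
    finally have "q powr (real n - 1/2) = q ^ (n - 1) * q powr (1/2)" .
    thus ?thesis by (simp add: s_def Q_def)
  qed
  define P where "P n a' b' l = askey_wilson n (inverse (of_real l) * x) (- s * a')
      (Q * b' * of_real l) (- s) (inverse (of_real l)) Q" for n a' b' and l :: real
  have first: "((\<lambda>l. of_real l ^ n * P n a b l) \<longlongrightarrow> little_q_jacobi n x a b Q) (at_right 0)" for n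
    unfolding P_def using assms(3,5) Q s
    by (intro askey_wilson_tendsto_little_q_jacobi) (auto simp: Q_def)
  have shifted: "((\<lambda>l. of_real l ^ n * P n (Q * a) (Q * b) l) \<longlongrightarrow>
      little_q_jacobi n x (Q * a) (Q * b) Q) (at_right 0)" for n
    unfolding P_def
  proof (intro askey_wilson_tendsto_little_q_jacobi Q s)
    show "Q * a \<noteq> 0" using Q assms(3) by simp
    show "Q ^ k * (Q * a) \<noteq> 1" if "k \<ge> 1" for k
      using assms(5)[rule_format, of "Suc k"] by (simp add: Q_def mult_ac)
  qed
  have shift_params: "Q * (- s * a) = - s * (Q * a)" "Q * (Q * b * l) = Q * (Q * b) * l" for l
    by (simp_all add: mult_ac)
  have nat_abs: "nat \<bar>- int n\<bar> = n" "nat \<bar>int n\<bar> = n" for n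
    by simp_all

  have neg: "((\<lambda>l. l ^ n *\<^sub>R nonsym_askey_wilson (- int n) (inverse (of_real l) * x)
         (- s * a) (Q * b * of_real l) (- s) (inverse (of_real l)) Q)
      \<longlongrightarrow> (little_q_jacobi n x a b Q,
        inverse (s * Q) * inverse a * inverse b * little_q_jacobi (n - 1) x (Q * a) (Q * b) Q))
      (at_right 0)" if n1: "n \<ge> 1" for n
  proof (rule Lim_transform_eventually)
    show "((\<lambda>l. (of_real l ^ n * P n a b l, inverse (s * Q) * inverse a * inverse b *
          (of_real l ^ (n - 1) * P (n - 1) (Q * a) (Q * b) l)))
      \<longlongrightarrow> (little_q_jacobi n x a b Q,
        inverse (s * Q) * inverse a * inverse b * little_q_jacobi (n - 1) x (Q * a) (Q * b) Q))
      (at_right 0)"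
      by (intro tendsto_Pair tendsto_mult tendsto_const first shifted)
    show "\<forall>\<^sub>F l in at_right 0. (of_real l ^ n * P n a b l, inverse (s * Q) * inverse a * inverse b *
          (of_real l ^ (n - 1) * P (n - 1) (Q * a) (Q * b) l)) =
        l ^ n *\<^sub>R nonsym_askey_wilson (- int n) (inverse (of_real l) * x)
         (- s * a) (Q * b * of_real l) (- s) (inverse (of_real l)) Q"
      using eventually_at_right_less[of "0::real"]
    proof eventually_elim
      case (elim l)
      obtain m where m: "n = Suc m" using n1 by (cases n) auto
      have nonsym: "nonsym_askey_wilson (- int n) (inverse (of_real l) * x)
          (- s * a) (Q * b * of_real l) (- s) (inverse (of_real l)) Q =
        (P n a b l, - (inverse (- s * a) * inverse (Q * b * of_real l) * P m (Q * a) (Q * b) l))"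
        unfolding nonsym_askey_wilson_def Let_def shift_params P_def nat_abs unfolding m by simp
      have coeff: "inverse (s * Q) * inverse a * inverse b * of_real l ^ m =
          - (of_real l ^ n * (inverse (- s * a) * inverse (Q * b * of_real l)))"
        using elim by (simp add: m)
      have "inverse (s * Q) * inverse a * inverse b * (of_real l ^ m * P m (Q * a) (Q * b) l) =
          of_real l ^ n * - (inverse (- s * a) * inverse (Q * b * of_real l) * P m (Q * a) (Q * b) l)"
        unfolding mult.assoc[symmetric, of _ "of_real l ^ m"] coeff
        by (simp only: mult_ac mult_minus_right mult_minus_left)
      thus ?case
        unfolding nonsym scaleR_Pair scaleR_conv_of_real of_real_power by (simp only: m diff_Suc_1)
    qed
  qed

  have pos: "((\<lambda>l. l ^ n *\<^sub>R nonsym_askey_wilson (int n) (inverse (of_real l) * x)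
         (- s * a) (Q * b * of_real l) (- s) (inverse (of_real l)) Q)
      \<longlongrightarrow> (little_q_jacobi n x a b Q,
        - (Q ^ (n - 1) * s * (1 - Q ^ n) / (1 - Q ^ (n + 1) * a * b) *
           little_q_jacobi (n - 1) x (Q * a) (Q * b) Q)))
      (at_right 0)" if n1: "n \<ge> 1" for n
  proof (rule Lim_transform_eventually)
    \<comment> \<open>\<open>c l\<close> is \<open>l\<close> times the coefficient of the second component; the spare \<open>l\<close> turns
      \<open>1 - q\<^bsup>n-1\<^esup> C D = 1 + q\<^bsup>n-1\<^esup> s / l\<close> into \<open>l + q\<^bsup>n-1\<^esup> s\<close>.\<close>
    define c where "c l = (1 - Q ^ n) * (of_real l + Q ^ (n - 1) * s) /
        ((1 - Q ^ n * (- s * a) * (Q * b * of_real l)) * (1 - Q ^ (n + 1) * a * b))" for l :: real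
    have "((\<lambda>l. (1 - Q ^ n) * (complex_of_real l + Q ^ (n - 1) * s) /
        (1 - Q ^ n * (- s * a) * (Q * b * of_real l)) / (1 - Q ^ (n + 1) * a * b)) \<longlongrightarrow>
        (1 - Q ^ n) * (of_real 0 + Q ^ (n - 1) * s) /
        (1 - Q ^ n * (- s * a) * (Q * b * of_real 0)) / (1 - Q ^ (n + 1) * a * b)) (at_right 0)"
      unfolding divide_inverse[of _ "1 - Q ^ (n + 1) * a * b"]
      by (intro tendsto_intros) simp
    hence c: "(c \<longlongrightarrow> Q ^ (n - 1) * s * (1 - Q ^ n) / (1 - Q ^ (n + 1) * a * b)) (at_right 0)"
      unfolding c_def by (simp add: mult_ac)
    show "((\<lambda>l. (of_real l ^ n * P n a b l,
          - (c l * (of_real l ^ (n - 1) * P (n - 1) (Q * a) (Q * b) l))))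
      \<longlongrightarrow> (little_q_jacobi n x a b Q,
        - (Q ^ (n - 1) * s * (1 - Q ^ n) / (1 - Q ^ (n + 1) * a * b) *
           little_q_jacobi (n - 1) x (Q * a) (Q * b) Q)))
      (at_right 0)"
      by (intro tendsto_Pair tendsto_minus tendsto_mult first shifted c)
    show "\<forall>\<^sub>F l in at_right 0. (of_real l ^ n * P n a b l,
          - (c l * (of_real l ^ (n - 1) * P (n - 1) (Q * a) (Q * b) l))) =
        l ^ n *\<^sub>R nonsym_askey_wilson (int n) (inverse (of_real l) * x)
         (- s * a) (Q * b * of_real l) (- s) (inverse (of_real l)) Q"
      using eventually_at_right_less[of "0::real"]
    proof eventually_elim
      case (elim l)
      define L where "L = complex_of_real l"
      have L: "L \<noteq> 0" using elim by (simp add: L_def)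
      obtain m where m: "n = Suc m" using n1 by (cases n) auto
      have abcd: "Q ^ m * (- s * a) * (Q * b * L) * (- s) * inverse L = Q ^ (n + 1) * a * b"
        using L by (simp add: m mult_ac flip: s)
      have cd: "L * (1 - Q ^ m * (- s) * inverse L) = L + Q ^ m * s"
        using L by (simp add: field_simps)
      have nonsym: "nonsym_askey_wilson (int n) (inverse L * x)
          (- s * a) (Q * b * L) (- s) (inverse L) Q =
        (P n a b l, - ((1 - Q ^ n) * (1 - Q ^ m * (- s) * inverse L) /
          ((1 - Q ^ n * (- s * a) * (Q * b * L)) *
           (1 - Q ^ m * (- s * a) * (Q * b * L) * (- s) * inverse L)) * P m (Q * a) (Q * b) l))"
        unfolding nonsym_askey_wilson_def Let_def shift_params P_def L_def nat_abs unfolding m by simp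
      have coeff: "c l = L * ((1 - Q ^ n) * (1 - Q ^ m * (- s) * inverse L) /
          ((1 - Q ^ n * (- s * a) * (Q * b * L)) * (1 - Q ^ (n + 1) * a * b)))"
        unfolding c_def L_def[symmetric] times_divide_eq_right mult.left_commute[of L] cd
        by (simp add: m)
      have "- (c l * (L ^ m * p)) = L ^ n * - ((1 - Q ^ n) * (1 - Q ^ m * (- s) * inverse L) /
          ((1 - Q ^ n * (- s * a) * (Q * b * L)) * (1 - Q ^ (n + 1) * a * b)) * p)" for p
        unfolding coeff m power_Suc by (simp only: mult_ac mult_minus_right)
      thus ?case
        unfolding L_def[symmetric] nonsym abcd scaleR_Pair scaleR_conv_of_real of_real_power
        by (simp only: m diff_Suc_1)
    qed
  qed

  have zero: "((\<lambda>l. l ^ 0 *\<^sub>R nonsym_askey_wilson (int 0) (inverse (of_real l) * x)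
         (- s * a) (Q * b * of_real l) (- s) (inverse (of_real l)) Q)
      \<longlongrightarrow> (little_q_jacobi 0 x a b Q, 0)) (at_right 0)"
    using tendsto_Pair[OF first[of 0] tendsto_const[of 0]]
    by (simp add: nonsym_askey_wilson_def P_def)

  show ?thesis
    unfolding Q_def[symmetric] s_def[symmetric] s_neg
  proof (intro conjI allI impI)
    fix n :: nat
    show "((\<lambda>l. l ^ n *\<^sub>R nonsym_askey_wilson (int n) (inverse (of_real l) * x)
         (- s * a) (Q * b * of_real l) (- s) (inverse (of_real l)) Q)
      \<longlongrightarrow> (little_q_jacobi n x a b Q,
        if n = 0 then 0
        else - (of_real (q powr (real n - 1/2)) * (1 - Q ^ n) / (1 - Q ^ (n + 1) * a * b) *
           little_q_jacobi (n - 1) x (Q * a) (Q * b) Q)))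
      (at_right 0)"
    proof (cases "n = 0")
      case True
      thus ?thesis using zero by simp
    next
      case False
      thus ?thesis using pos[of n] s_pos[of n] by simp
    qed
  qed (rule neg)
qed

end
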